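(* For each $n$ let $s=s_n\in\{1,\ldots,n\}$, $m=m_n>0$, $\mu=\mu_n>0$, and let $\mathcal{C}=\mathcal{C}_n$ be a symmetric and full range class of subsets of $\{1,\ldots,n\}$ with cardinality $s$. Let $\hat\Phi_n$ be an arbitrary adaptive sensing testing procedure (a sensing strategy with budget $m$ together with a test based on the resulting data). If $$\lim_{n\to\infty}R(\hat\Phi_n)=0,\qquad R(\hat\Phi_n)=\mathbb{P}_\emptyset(\hat\Phi_n\neq 0)+\max_{S\in\mathcal{C}}\mathbb{P}_S(\hat\Phi_n\neq 1),$$ then necessarily there is a sequence $\omega_n$ with $\lim_{n\to\infty}\omega_n=\infty$ such that the signal magnitude $x_{\min}=\mu$ satisfies $$x_{\min}\ \ge\ \omega_n\sqrt{\frac{n}{sm}}.$$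
   Context: Signal model: for $S\subseteq\{1,\ldots,n\}$ the signal $\vec{x}\in\mathbb{R}^n$ with support $S$ is given by $x_i=\mu$ if $i\in S$ and $x_i=0$ otherwise; for $S\ne\emptyset$, $x_{\min}=\min\{|x_i|:x_i\neq0\}=\mu$. Adaptive sensing: one observes $Y_k=x_{A_k}+\Gamma_k^{-1}W_k$, $k=1,2,\ldots$, where $A_k\in\{1,\ldots,n\}$ is the entry measured at time $k$ and $\Gamma_k^2$ is the precision of that measurement. The pair $(A_k,\Gamma_k)$ is chosen as a (possibly randomized) function of the past $\{Y_i,A_i,\Gamma_i\}_{i=1}^{k-1}$; the $W_k$ are standard normal, each $W_k$ being independent of $\{Y_i\}_{i=1}^{k-1}$, $\{A_i,\Gamma_i\}_{i=1}^{k}$ (and of any extra randomization). The sensing strategy is the collection of conditional distributions of $(A_k,\Gamma_k)$ given $\{Y_i,A_i,\Gamma_i\}_{i=1}^{k-1}$, for all $k$; it does not depend on the unknown $S$. The budget constraint is $\sum_{k=1}^\infty\Gamma_k^2\le m$ (almost surely). Convention: $\Gamma_k=0$ is allowed and means that no (informative) measurement is made at step $k$. $\mathbb{P}_S$ denotes the law of $D=\{Y_i,A_i,\Gamma_i\}_{i\in\mathbb{N}}$ when the support is $S$. A test is a $\{0,1\}$-valued measurable function of $D$. Symmetric class: a nonempty class $\mathcal{C}$ of subsets of $\{1,\ldots,n\}$, all of cardinality $s$, such that for $S$ drawn uniformly at random from $\mathcal{C}$ one has $\mathbb{P}(i\in S)=s/|\Xi|$ for all $i\in\Xi=\bigcup_{S\in\mathcal{C}}S$.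 The class is full range if $|\Xi|=n$. *)

theory Defs
  imports "HOL-Probability.Probability"
begin

definition signal :: "real \<Rightarrow> nat set \<Rightarrow> nat \<Rightarrow> real" where
  "signal \<mu> S i = (if i \<in> S then \<mu> else 0)"

definition x_min :: "nat \<Rightarrow> (nat \<Rightarrow> real) \<Rightarrow> real" where
  "x_min n x = Min {\<bar>x i\<bar> |i. i \<in> {1..n} \<and> x i \<noteq> 0}"

text \<open>An action is a pair \<open>(A, \<Gamma>)\<close>, an observation a triple \<open>(Y, A, \<Gamma>)\<close>.\<close>

definition action_space :: "nat \<Rightarrow> (nat \<times> real) measure" where
  "action_space n = count_space {1..n} \<Otimes>\<^sub>M borel"

definition obs_space :: "nat \<Rightarrow> (real \<times> nat \<times> real) measure" where
  "obs_space n = borel \<Otimes>\<^sub>M action_space n"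

text \<open>Time is counted from \<open>0\<close>: the history available at step \<open>k\<close> consists of the
  observations with indices in \<open>{0..<k}\<close>.\<close>

definition history_space :: "nat \<Rightarrow> nat \<Rightarrow> (nat \<Rightarrow> real \<times> nat \<times> real) measure" where
  "history_space n k = PiM {0..<k} (\<lambda>_. obs_space n)"

definition data_space :: "nat \<Rightarrow> (nat \<Rightarrow> real \<times> nat \<times> real) measure" where
  "data_space n = PiM UNIV (\<lambda>_. obs_space n)"

type_synonym strategy = "nat \<Rightarrow> (nat \<Rightarrow> real \<times> nat \<times> real) \<Rightarrow> (nat \<times> real) measure"

text \<open>\<open>K k h\<close> is the conditional distribution of the action at step \<open>k\<close> given the history \<open>h\<close>.\<close>

definition sensing_strategy :: "nat \<Rightarrow> strategy \<Rightarrow> bool" where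
  "sensing_strategy n K \<longleftrightarrow>
     (\<forall>k. K k \<in> history_space n k \<rightarrow>\<^sub>M prob_algebra (action_space n))"

text \<open>The case \<open>\<gamma> = 0\<close> has to be separated: since \<open>inverse 0 = 0\<close>, the formula
  \<open>x a + inverse \<gamma> * w\<close> would then reveal \<open>x a\<close> without noise and at no cost. Instead,
  a constant is recorded in place of the missing measurement.\<close>

definition measure_entry :: "(nat \<Rightarrow> real) \<Rightarrow> nat \<times> real \<Rightarrow> real \<Rightarrow> real \<times> nat \<times> real" where
  "measure_entry x = (\<lambda>(a, \<gamma>) w. (if \<gamma> = 0 then 0 else x a + inverse \<gamma> * w, a, \<gamma>))"

text \<open>Conditional distribution of \<open>(Y, A, \<Gamma>)\<close> at step \<open>k\<close> given the history \<open>h\<close>: the noise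
  is standard normal and independent of the history and of the action.\<close>

definition obs_kernel :: "nat \<Rightarrow> (nat \<Rightarrow> real) \<Rightarrow> strategy \<Rightarrow> nat \<Rightarrow>
    (nat \<Rightarrow> real \<times> nat \<times> real) \<Rightarrow> (real \<times> nat \<times> real) measure" where
  "obs_kernel n x K k h = K k h \<bind>
     (\<lambda>a. distr std_normal_distribution (obs_space n) (measure_entry x a))"

text \<open>The law of the whole data sequence, obtained from the conditional distributions by
  the Ionescu-Tulcea theorem; see \<open>Ionescu_Tulcea_obs_kernel\<close> and \<open>distr_data_law\<close> below.\<close>

definition data_law :: "nat \<Rightarrow> (nat \<Rightarrow> real) \<Rightarrow> strategy \<Rightarrow> (nat \<Rightarrow> real \<times> nat \<times> real) measure" where
  "data_law n x K =
     projective_family.lim UNIV (Ionescu_Tulcea.CI (obs_kernel n x K) (\<lambda>_. obs_space n)) (\<lambda>_. obs_space n)"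

abbreviation law :: "nat \<Rightarrow> real \<Rightarrow> strategy \<Rightarrow> nat set \<Rightarrow> (nat \<Rightarrow> real \<times> nat \<times> real) measure" where
  "law n \<mu> K S \<equiv> data_law n (signal \<mu> S) K"

definition within_budget :: "nat \<Rightarrow> real \<Rightarrow> real \<Rightarrow> nat set set \<Rightarrow> strategy \<Rightarrow> bool" where
  "within_budget n m \<mu> \<C> K \<longleftrightarrow>
     (\<forall>S\<in>insert {} \<C>. AE D in law n \<mu> K S. (\<Sum>k. ennreal ((snd (snd (D k)))\<^sup>2)) \<le> ennreal m)"

definition is_test :: "nat \<Rightarrow> ((nat \<Rightarrow> real \<times> nat \<times> real) \<Rightarrow> nat) \<Rightarrow> bool" where
  "is_test n \<Phi> \<longleftrightarrow> \<Phi> \<in> data_space n \<rightarrow>\<^sub>M count_space {0, 1}"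

definition risk :: "nat \<Rightarrow> real \<Rightarrow> nat set set \<Rightarrow> strategy \<Rightarrow>
    ((nat \<Rightarrow> real \<times> nat \<times> real) \<Rightarrow> nat) \<Rightarrow> real" where
  "risk n \<mu> \<C> K \<Phi> =
     \<P>(D in law n \<mu> K {}. \<Phi> D \<noteq> 0) + (MAX S\<in>\<C>. \<P>(D in law n \<mu> K S. \<Phi> D \<noteq> 1))"

definition symmetric_class :: "nat \<Rightarrow> nat \<Rightarrow> nat set set \<Rightarrow> bool" where
  "symmetric_class n s \<C> \<longleftrightarrow>
     \<C> \<noteq> {} \<and> \<C> \<subseteq> Pow {1..n} \<and> (\<forall>S\<in>\<C>. card S = s) \<and>
     (\<forall>i\<in>\<Union>\<C>. measure_pmf.prob (pmf_of_set \<C>) {S. i \<in> S} = real s / real (card (\<Union>\<C>)))"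

definition full_range :: "nat \<Rightarrow> nat set set \<Rightarrow> bool" where
  "full_range n \<C> \<longleftrightarrow> card (\<Union>\<C>) = n"

lemma measurable_measure_entry:
  "case_prod (measure_entry x) \<in> action_space n \<Otimes>\<^sub>M borel \<rightarrow>\<^sub>M obs_space n"
proof -
  have "x \<in> measurable (count_space {1..n}) borel" by simp
  then show ?thesis
    unfolding measure_entry_def action_space_def obs_space_def case_prod_beta'
    by measurable
qed

lemma measurable_obs_kernel:
  assumes "sensing_strategy n K"
  shows "obs_kernel n x K k \<in> PiM {0..<k} (\<lambda>_. obs_space n) \<rightarrow>\<^sub>M prob_algebra (obs_space n)"
proof -
  have K: "K k \<in> PiM {0..<k} (\<lambda>_. obs_space n) \<rightarrow>\<^sub>M prob_algebra (action_space n)"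
    using assms by (simp add: sensing_strategy_def history_space_def)
  let ?N = "std_normal_distribution"
  have N: "?N \<in> space (prob_algebra borel)"
    by (simp add: space_prob_algebra prob_space_normal_density)
  have "(\<lambda>a. distr ?N (obs_space n) (measure_entry x a))
      \<in> action_space n \<rightarrow>\<^sub>M prob_algebra (obs_space n)"
    by (rule measurable_distr_prob_space2[OF measurable_const[OF N]])
       (rule measurable_measure_entry)
  then show ?thesis
    unfolding obs_kernel_def[abs_def] by (rule measurable_bind_prob_space[OF K])
qed

lemma Ionescu_Tulcea_obs_kernel:
  assumes "sensing_strategy n K"
  shows "Ionescu_Tulcea (obs_kernel n x K) (\<lambda>_. obs_space n)"
proof (unfold Ionescu_Tulcea_def, intro conjI allI impI)
  fix i
  show "obs_kernel n x K i \<in> PiM {0..<i} (\<lambda>_. obs_space n) \<rightarrow>\<^sub>M subprob_algebra (obs_space n)"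
    using measurable_obs_kernel[OF assms] by (rule measurable_prob_algebraD)
  fix h assume "h \<in> space (PiM {0..<i} (\<lambda>_. obs_space n))"
  from measurable_space[OF measurable_obs_kernel[OF assms] this]
  show "prob_space (obs_kernel n x K i h)" by (simp add: space_prob_algebra)
qed

lemma sets_data_law:
  assumes "sensing_strategy n K"
  shows "sets (data_law n x K) = sets (data_space n)"
proof -
  interpret Ionescu_Tulcea "obs_kernel n x K" "\<lambda>_. obs_space n"
    using assms by (rule Ionescu_Tulcea_obs_kernel)
  show ?thesis
    unfolding data_law_def data_space_def by simp
qed

lemma distr_data_law:
  assumes "sensing_strategy n K"
  shows "distr (data_law n x K) (history_space n k) (\<lambda>D. restrict D {0..<k}) =
    Ionescu_Tulcea.C (obs_kernel n x K) (\<lambda>_. obs_space n) 0 k (\<lambda>_. undefined)"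
proof -
  interpret Ionescu_Tulcea "obs_kernel n x K" "\<lambda>_. obs_space n"
    using assms by (rule Ionescu_Tulcea_obs_kernel)
  note sets = sets_data_law[OF assms, of x, unfolded data_space_def]
  have init: "(\<lambda>_. undefined) \<in> space (PiM {0..<0::nat} (\<lambda>_. obs_space n))"
    by (simp add: space_PiM)
  show ?thesis
  proof (rule measure_eqI)
    show "sets (distr (data_law n x K) (history_space n k) (\<lambda>D. restrict D {0..<k})) =
      sets (C 0 k (\<lambda>_. undefined))"
      using sets_C[OF init, of k] by (simp add: history_space_def)
    fix X assume "X \<in> sets (distr (data_law n x K) (history_space n k) (\<lambda>D. restrict D {0..<k}))"
    then have X: "X \<in> sets (PiM {0..<k} (\<lambda>_. obs_space n))"
      by (simp add: history_space_def)
    have r: "(\<lambda>D. restrict D {0..<k}) \<in> data_law n x K \<rightarrow>\<^sub>M PiM {0..<k} (\<lambda>_. obs_space n)"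
      by (subst measurable_cong_sets[OF sets refl]) (rule measurable_restrict_subset, simp)
    have "emeasure (distr (data_law n x K) (history_space n k) (\<lambda>D. restrict D {0..<k})) X =
      emeasure (data_law n x K) (prod_emb UNIV (\<lambda>_. obs_space n) {0..<k} X)"
      unfolding history_space_def emeasure_distr[OF r X]
      by (simp add: prod_emb_def sets_eq_imp_space_eq[OF sets] space_PiM)
    also have "\<dots> = emeasure (C 0 k (\<lambda>_. undefined)) X"
      unfolding data_law_def lim[OF finite_atLeastLessThan X] emeasure_CI[OF subset_refl X]
      by (simp add: prod_emb_id[OF sets.sets_into_space[OF X, unfolded space_PiM]])
    finally show "emeasure (distr (data_law n x K) (history_space n k) (\<lambda>D. restrict D {0..<k})) X =
      emeasure (C 0 k (\<lambda>_. undefined)) X" .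
  qed
qed

lemma prob_space_data_law:
  assumes "sensing_strategy n K"
  shows "prob_space (data_law n x K)"
proof -
  interpret Ionescu_Tulcea "obs_kernel n x K" "\<lambda>_. obs_space n"
    using assms by (rule Ionescu_Tulcea_obs_kernel)
  have r: "(\<lambda>D. restrict D {0..<0}) \<in> data_law n x K \<rightarrow>\<^sub>M history_space n 0"
    unfolding history_space_def
    by (subst measurable_cong_sets[OF sets_data_law[OF assms, of x, unfolded data_space_def] refl])
       (rule measurable_restrict_subset, simp)
  have "prob_space (C 0 0 (\<lambda>_. undefined))"
    by (rule prob_space_C) (simp add: space_PiM)
  then have "prob_space (distr (data_law n x K) (history_space n 0) (\<lambda>D. restrict D {0..<0}))"
    unfolding distr_data_law[OF assms] .
  then show ?thesis
    by (rule prob_space_distrD[OF r])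
qed

end

theory Submission
  imports Defs
begin

text \<open>Let \<open>P\<close> be the law under the null and \<open>Q\<close> the law for a support \<open>S\<close>. The
  Kullback-Leibler divergence of \<open>P\<close> from \<open>Q\<close> is \<open>\<mu>\<^sup>2 / 2\<close> times the expected precision that the
  strategy spends on \<open>S\<close> under \<open>P\<close>. By symmetry of the class the average over \<open>S\<close> of this precision
  is at most \<open>s m / n\<close>, so that some \<open>S\<close> has divergence at most \<open>\<kappa> = \<mu>\<^sup>2 s m / (2 n)\<close>. With \<open>L\<close>
  the likelihood ratio on a finite history, Markov's inequality for \<open>L - 1 - ln L \<ge> 0\<close>, whose
  mean under \<open>P\<close> is the divergence, shows \<open>L \<ge> exp (- 2 \<kappa> - 1)\<close> with \<open>P\<close>-probability at least \<open>1 / 2\<close>.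
  Hence no test based on a finite history has total error below \<open>exp (- 2 \<kappa> - 1) / 2\<close>, and every
  test is approximated by such tests. Vanishing risk therefore forces \<open>\<mu>\<^sup>2 s m / n\<close> to infinity.\<close>

section \<open>Gaussian integrals\<close>

text \<open>Completing the square: the density translated by \<open>c\<close> is the standard one
  times \<open>exp (c * w - c\<^sup>2 / 2)\<close>. This tilt is the likelihood ratio of a shifted
  normal to a centred one (one-dimensional Cameron-Martin formula).\<close>

lemma nn_integral_std_normal_shift:
  fixes f :: "real \<Rightarrow> ennreal"
  assumes [measurable]: "f \<in> borel_measurable borel"
  shows "(\<integral>\<^sup>+w. f (w + c) \<partial>std_normal_distribution) =
    (\<integral>\<^sup>+w. ennreal (exp (c * w - c\<^sup>2 / 2)) * f w \<partial>std_normal_distribution)"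
proof -
  have "- (w - c)\<^sup>2 / 2 = - w\<^sup>2 / 2 + (c * w - c\<^sup>2 / 2)" for w
    by (simp add: power2_eq_square algebra_simps add_divide_distrib diff_divide_distrib)
  then have shift: "std_normal_density (w - c) = std_normal_density w * exp (c * w - c\<^sup>2 / 2)" for w
    by (simp add: std_normal_density_def flip: exp_add)
  have "(\<integral>\<^sup>+w. f (w + c) \<partial>std_normal_distribution) =
      (\<integral>\<^sup>+w. ennreal (std_normal_density w) * f (w + c) \<partial>lborel)"
    by (simp add: nn_integral_density)
  also have "\<dots> = (\<integral>\<^sup>+w. ennreal (std_normal_density (w - c)) * f w \<partial>lborel)"
    by (subst nn_integral_real_affine[of _ 1 "-c"]) auto
  also have "\<dots> = (\<integral>\<^sup>+w. ennreal (std_normal_density w) * (ennreal (exp (c * w - c\<^sup>2 / 2)) * f w) \<partial>lborel)"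
    unfolding shift by (simp add: ennreal_mult mult.assoc)
  also have "\<dots> = (\<integral>\<^sup>+w. ennreal (exp (c * w - c\<^sup>2 / 2)) * f w \<partial>std_normal_distribution)"
    by (simp add: nn_integral_density)
  finally show ?thesis .
qed

text \<open>Compared with \<open>- ln L\<close>, the additional \<open>L - 1\<close> makes the function nonnegative, so that nonnegative integrals suffice;
  it does not change the mean, since \<open>L\<close> has mean \<open>1\<close>.\<close>

definition log_gap :: "real \<Rightarrow> real" where
  "log_gap t = t - 1 - ln t"

lemma log_gap_nonneg: "t > 0 \<Longrightarrow> 0 \<le> log_gap t"
  using ln_le_minus_one[of t] by (simp add: log_gap_def)

lemma measurable_log_gap[measurable]: "log_gap \<in> borel_measurable borel"
  unfolding log_gap_def[abs_def] by measurable

text \<open>The factor \<open>c\<close> stands for the likelihood ratio of the past, fixed by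
  conditioning. After expanding the logarithm, the tilt has mean 1 (shift formula for the constant
  1) and \<open>w\<close> has mean 0, so that just the quadratic term is added to
  \<open>log_gap c\<close>: a one-step chain rule for the divergence.\<close>

lemma nn_integral_std_normal_log_gap:
  assumes c: "c > 0"
  shows "(\<integral>\<^sup>+w. ennreal (log_gap (c * exp (b * w - b\<^sup>2 / 2))) \<partial>std_normal_distribution) =
    ennreal (log_gap c) + ennreal (b\<^sup>2 / 2)"
proof -
  interpret N: prob_space std_normal_distribution
    by (rule prob_space_normal_density) simp
  have one: "has_bochner_integral std_normal_distribution (\<lambda>_. 1 :: real) 1"
    using N.prob_space by (simp add: has_bochner_integral_iff)
  have lin: "has_bochner_integral std_normal_distribution (\<lambda>w. w) 0"
    using std_normal_moment_odd[of 0] by (simp add: has_bochner_integral_density)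
  have "(\<integral>\<^sup>+w. ennreal (exp (b * w - b\<^sup>2 / 2)) \<partial>std_normal_distribution) = ennreal 1"
    using nn_integral_std_normal_shift[of "\<lambda>_. 1" b] N.emeasure_space_1 by simp
  then have ex: "has_bochner_integral std_normal_distribution (\<lambda>w. exp (b * w - b\<^sup>2 / 2)) 1"
    by (intro has_bochner_integral_nn_integral) auto
  have "has_bochner_integral std_normal_distribution
      (\<lambda>w. c * exp (b * w - b\<^sup>2 / 2) - (1 + ln c - b\<^sup>2 / 2) * 1 - b * w)
      (c * 1 - (1 + ln c - b\<^sup>2 / 2) * 1 - b * 0)"
    by (intro has_bochner_integral_diff has_bochner_integral_mult_right one lin ex)
  also have "(\<lambda>w. c * exp (b * w - b\<^sup>2 / 2) - (1 + ln c - b\<^sup>2 / 2) * 1 - b * w) =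
      (\<lambda>w. log_gap (c * exp (b * w - b\<^sup>2 / 2)))"
    using c by (auto simp: log_gap_def ln_mult)
  also have "c * 1 - (1 + ln c - b\<^sup>2 / 2) * 1 - b * 0 = log_gap c + b\<^sup>2 / 2"
    by (simp add: log_gap_def)
  finally have *: "has_bochner_integral std_normal_distribution
      (\<lambda>w. log_gap (c * exp (b * w - b\<^sup>2 / 2))) (log_gap c + b\<^sup>2 / 2)" .
  have "(\<integral>\<^sup>+w. ennreal (log_gap (c * exp (b * w - b\<^sup>2 / 2))) \<partial>std_normal_distribution) =
      ennreal (log_gap c + b\<^sup>2 / 2)"
    using * c by (subst nn_integral_eq_integral) (auto simp: has_bochner_integral_iff log_gap_nonneg)
  then show ?thesis
    using log_gap_nonneg[OF c] by simp
qed

section \<open>Likelihood ratio and information of one observation\<close>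

text \<open>The density ratio of \<open>N(x a, \<gamma>\<^sup>-\<^sup>2)\<close> to \<open>N(0, \<gamma>\<^sup>-\<^sup>2)\<close> at \<open>y\<close>; it is \<open>1\<close>
  for a void measurement, i.e. for \<open>\<gamma> = 0\<close>.\<close>

definition obs_ratio :: "(nat \<Rightarrow> real) \<Rightarrow> real \<times> nat \<times> real \<Rightarrow> real" where
  "obs_ratio x = (\<lambda>(y, a, \<gamma>). exp (\<gamma>\<^sup>2 * (x a * y - (x a)\<^sup>2 / 2)))"

text \<open>The Kullback-Leibler divergence of \<open>N(0, \<gamma>\<^sup>-\<^sup>2)\<close> from
  \<open>N(x a, \<gamma>\<^sup>-\<^sup>2)\<close>, and 0 for a void measurement. Values in
  \<open>ennreal\<close> make infinite sums over time exist without a convergence proof.\<close>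

definition obs_info :: "(nat \<Rightarrow> real) \<Rightarrow> real \<times> nat \<times> real \<Rightarrow> ennreal" where
  "obs_info x = (\<lambda>(y, a, \<gamma>). ennreal ((\<gamma> * x a)\<^sup>2 / 2))"

text \<open>Actions contribute no factor: given the history, their conditional law is the same for
  every signal and cancels in the likelihood ratio.\<close>

definition path_ratio :: "(nat \<Rightarrow> real) \<Rightarrow> nat \<Rightarrow> (nat \<Rightarrow> real \<times> nat \<times> real) \<Rightarrow> real" where
  "path_ratio x k h = (\<Prod>i<k. obs_ratio x (h i))"

lemma obs_ratio_pos: "obs_ratio x z > 0"
  by (simp add: obs_ratio_def split: prod.split)

lemma path_ratio_pos: "path_ratio x k h > 0"
  by (simp add: path_ratio_def obs_ratio_pos prod_pos)

lemma path_ratio_fun_upd: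
  "path_ratio x (Suc k) (h(k := z)) = path_ratio x k h * obs_ratio x z"
  by (simp add: path_ratio_def)

lemma measurable_obs_ratio[measurable]: "obs_ratio x \<in> borel_measurable (obs_space n)"
proof -
  have [measurable]: "x \<in> measurable (count_space {1..n}) borel" by simp
  show ?thesis
    unfolding obs_ratio_def obs_space_def action_space_def case_prod_beta' by measurable
qed

lemma measurable_obs_info[measurable]: "obs_info x \<in> borel_measurable (obs_space n)"
proof -
  have [measurable]: "x \<in> measurable (count_space {1..n}) borel" by simp
  show ?thesis
    unfolding obs_info_def obs_space_def action_space_def case_prod_beta' by measurable
qed

lemma measurable_path_ratio[measurable]:
  "path_ratio x k \<in> borel_measurable (history_space n k)"
proof -
  have [measurable]: "(\<lambda>h. h i) \<in> history_space n k \<rightarrow>\<^sub>M obs_space n" if "i < k" for i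
    using that unfolding history_space_def by (intro measurable_component_singleton) auto
  show ?thesis
    unfolding path_ratio_def[abs_def] by measurable
qed

text \<open>For \<open>\<gamma> \<noteq> 0\<close> the observation is
  \<open>(w + \<gamma> * x i) / \<gamma>\<close>, so the Gaussian shift by
  \<open>\<gamma> * x i\<close> applies to the noise. For \<open>\<gamma> = 0\<close> the record
  does not depend on \<open>x\<close> and the ratio is 1; here the convention for void measurements
  enters.\<close>

lemma nn_integral_measure_entry:
  assumes g[measurable]: "g \<in> borel_measurable (obs_space n)" and a: "fst a \<in> {1..n}"
  shows "(\<integral>\<^sup>+w. g (measure_entry x a w) \<partial>std_normal_distribution) =
    (\<integral>\<^sup>+w. ennreal (obs_ratio x (measure_entry (\<lambda>_. 0) a w)) * g (measure_entry (\<lambda>_. 0) a w)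
      \<partial>std_normal_distribution)"
proof (cases "snd a = 0")
  case True
  then show ?thesis
    by (simp add: measure_entry_def obs_ratio_def case_prod_beta')
next
  case False
  obtain i \<gamma> where [simp]: "a = (i, \<gamma>)" by (cases a)
  have nz: "\<gamma> \<noteq> 0" using False by simp
  have [measurable]: "(\<lambda>w. (w / \<gamma>, i, \<gamma>)) \<in> borel \<rightarrow>\<^sub>M obs_space n"
    using a unfolding obs_space_def action_space_def
    by measurable (use a in \<open>auto simp: space_pair_measure\<close>)
  have ratio: "obs_ratio x (w / \<gamma>, i, \<gamma>) = exp ((\<gamma> * x i) * w - (\<gamma> * x i)\<^sup>2 / 2)" for w
    using nz by (simp add: obs_ratio_def power2_eq_square right_diff_distrib)
  have "(\<integral>\<^sup>+w. g (measure_entry x a w) \<partial>std_normal_distribution) =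
      (\<integral>\<^sup>+w. g ((w + \<gamma> * x i) / \<gamma>, i, \<gamma>) \<partial>std_normal_distribution)"
    using nz by (intro nn_integral_cong) (simp add: measure_entry_def field_simps)
  also have "\<dots> = (\<integral>\<^sup>+w. ennreal (exp ((\<gamma> * x i) * w - (\<gamma> * x i)\<^sup>2 / 2)) * g (w / \<gamma>, i, \<gamma>)
      \<partial>std_normal_distribution)"
    by (rule nn_integral_std_normal_shift[of "\<lambda>w. g (w / \<gamma>, i, \<gamma>)"]) measurable
  also have "\<dots> = (\<integral>\<^sup>+w. ennreal (obs_ratio x (measure_entry (\<lambda>_. 0) a w)) *
      g (measure_entry (\<lambda>_. 0) a w) \<partial>std_normal_distribution)"
    using nz by (intro nn_integral_cong) (simp add: measure_entry_def inverse_eq_divide ratio)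
  finally show ?thesis .
qed

text \<open>The 0 is a placeholder: information is a function of the action alone, so integrating it
  over the noise changes nothing.\<close>

lemma obs_info_measure_entry: "obs_info x (measure_entry y a w) = obs_info x (0, a)"
  by (simp add: obs_info_def measure_entry_def split: prod.split)

lemma nn_integral_log_gap_measure_entry:
  assumes c: "c > 0"
  shows "(\<integral>\<^sup>+w. ennreal (log_gap (c * obs_ratio x (measure_entry (\<lambda>_. 0) a w)))
      \<partial>std_normal_distribution) = ennreal (log_gap c) + obs_info x (0, a)"
proof -
  obtain i \<gamma> where [simp]: "a = (i, \<gamma>)" by (cases a)
  \<comment> \<open>Under the null signal the observation is \<open>w / \<gamma>\<close>, so the
    ratio is a tilt in \<open>w\<close>; for \<open>\<gamma> = 0\<close> both sides are
    \<open>exp 0\<close>.\<close>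
  have "obs_ratio x (measure_entry (\<lambda>_. 0) a w) = exp ((\<gamma> * x i) * w - (\<gamma> * x i)\<^sup>2 / 2)" for w
    by (cases "\<gamma> = 0") (simp_all add: measure_entry_def obs_ratio_def field_simps power2_eq_square)
  then show ?thesis
    using nn_integral_std_normal_log_gap[OF c, of "\<gamma> * x i"] by (simp add: obs_info_def)
qed

section \<open>Laws of finite histories\<close>

text \<open>The start \<open>\<lambda>_. undefined\<close> is the only point of the product over the
  empty index set.\<close>

abbreviation history_law :: "nat \<Rightarrow> (nat \<Rightarrow> real) \<Rightarrow> strategy \<Rightarrow> nat \<Rightarrow> (nat \<Rightarrow> real \<times> nat \<times> real) measure" where
  "history_law n x K k \<equiv> Ionescu_Tulcea.C (obs_kernel n x K) (\<lambda>_. obs_space n) 0 k (\<lambda>_. undefined)"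

lemma sets_history_law:
  assumes "sensing_strategy n K"
  shows "sets (history_law n x K k) = sets (history_space n k)"
proof -
  interpret Ionescu_Tulcea "obs_kernel n x K" "\<lambda>_. obs_space n"
    using assms by (rule Ionescu_Tulcea_obs_kernel)
  show ?thesis
    using sets_C[of "\<lambda>_. undefined" 0 k] by (simp add: history_space_def space_PiM)
qed

lemma prob_space_history_law:
  assumes "sensing_strategy n K"
  shows "prob_space (history_law n x K k)"
proof -
  interpret Ionescu_Tulcea "obs_kernel n x K" "\<lambda>_. obs_space n"
    using assms by (rule Ionescu_Tulcea_obs_kernel)
  show ?thesis
    by (rule prob_space_C) (simp add: space_PiM)
qed

lemma
  assumes K: "sensing_strategy n K" and h: "h \<in> space (history_space n k)"
  shows sets_obs_kernel: "sets (obs_kernel n x K k h) = sets (obs_space n)"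
    and prob_space_obs_kernel: "prob_space (obs_kernel n x K k h)"
  using measurable_space[OF measurable_obs_kernel[OF K] h[unfolded history_space_def]]
  by (simp_all add: space_prob_algebra)

lemma measurable_history_fun_upd:
  assumes "h \<in> space (history_space n k)"
  shows "(\<lambda>z. h(k := z)) \<in> obs_space n \<rightarrow>\<^sub>M history_space n (Suc k)"
  using assms unfolding history_space_def
  by (intro measurable_fun_upd[where J="{0..<k}"]) auto

lemma strategy_in_prob_algebra:
  assumes K: "sensing_strategy n K" and h: "h \<in> space (history_space n k)"
  shows "K k h \<in> space (prob_algebra (action_space n))"
  by (rule measurable_space[OF _ h]) (use K in \<open>simp add: sensing_strategy_def\<close>)

lemma
  assumes K: "sensing_strategy n K" and h: "h \<in> space (history_space n k)"
  shows sets_strategy: "sets (K k h) = sets (action_space n)"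
    and space_strategy: "space (K k h) = space (action_space n)"
    and prob_space_strategy: "prob_space (K k h)"
proof -
  show *: "sets (K k h) = sets (action_space n)" and "prob_space (K k h)"
    using strategy_in_prob_algebra[OF K h] by (simp_all add: space_prob_algebra)
  from * show "space (K k h) = space (action_space n)"
    by (rule sets_eq_imp_space_eq)
qed

lemma nn_integral_obs_kernel:
  assumes K: "sensing_strategy n K" and h: "h \<in> space (history_space n k)"
    and g: "g \<in> borel_measurable (obs_space n)"
  shows "(\<integral>\<^sup>+z. g z \<partial>obs_kernel n x K k h) =
    (\<integral>\<^sup>+a. \<integral>\<^sup>+w. g (measure_entry x a w) \<partial>std_normal_distribution \<partial>K k h)"
proof -
  let ?N = "std_normal_distribution"
  have N: "?N \<in> space (prob_algebra borel)"
    by (simp add: space_prob_algebra prob_space_normal_density)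
  note s = sets_strategy[OF K h] and sp = space_strategy[OF K h]
  have "(\<lambda>a. distr ?N (obs_space n) (measure_entry x a))
      \<in> action_space n \<rightarrow>\<^sub>M prob_algebra (obs_space n)"
    by (rule measurable_distr_prob_space2[OF measurable_const[OF N]])
       (rule measurable_measure_entry)
  then have D: "(\<lambda>a. distr ?N (obs_space n) (measure_entry x a))
      \<in> K k h \<rightarrow>\<^sub>M subprob_algebra (obs_space n)"
    by (intro measurable_prob_algebraD) (simp add: measurable_cong_sets[OF s refl])
  have "(\<integral>\<^sup>+z. g z \<partial>obs_kernel n x K k h) =
      (\<integral>\<^sup>+a. \<integral>\<^sup>+z. g z \<partial>distr ?N (obs_space n) (measure_entry x a) \<partial>K k h)"
    unfolding obs_kernel_def by (rule nn_integral_bind[OF g D])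
  also have "\<dots> = (\<integral>\<^sup>+a. \<integral>\<^sup>+w. g (measure_entry x a w) \<partial>?N \<partial>K k h)"
  proof (intro nn_integral_cong)
    fix a assume "a \<in> space (K k h)"
    then have "measure_entry x a \<in> borel \<rightarrow>\<^sub>M obs_space n"
      using measurable_Pair2[OF measurable_measure_entry[of x n], of a] sp by simp
    then show "(\<integral>\<^sup>+z. g z \<partial>distr ?N (obs_space n) (measure_entry x a)) =
        (\<integral>\<^sup>+w. g (measure_entry x a w) \<partial>?N)"
      by (intro nn_integral_distr) (simp_all add: g)
  qed
  finally show ?thesis .
qed

text \<open>The Ionescu-Tulcea construction binds the law up to \<open>k\<close> with
  \<open>eP k\<close>, which appends an observation drawn from \<open>obs_kernel\<close>. This
  unfolding drives the inductions on \<open>k\<close> below.\<close>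

lemma nn_integral_history_law_Suc:
  assumes K: "sensing_strategy n K" and f: "f \<in> borel_measurable (history_space n (Suc k))"
  shows "(\<integral>\<^sup>+h. f h \<partial>history_law n x K (Suc k)) =
    (\<integral>\<^sup>+h. \<integral>\<^sup>+z. f (h(k := z)) \<partial>obs_kernel n x K k h \<partial>history_law n x K k)"
proof -
  interpret Ionescu_Tulcea "obs_kernel n x K" "\<lambda>_. obs_space n"
    using K by (rule Ionescu_Tulcea_obs_kernel)
  have init: "(\<lambda>_. undefined) \<in> space (PiM {0..<0::nat} (\<lambda>_. obs_space n))"
    by (simp add: space_PiM)
  have "(\<integral>\<^sup>+h. f h \<partial>C 0 (Suc k) (\<lambda>_. undefined)) =
      (\<integral>\<^sup>+h. \<integral>\<^sup>+h'. f h' \<partial>eP k h \<partial>C 0 k (\<lambda>_. undefined))"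
    using f measurable_eP[of k] sets_C[OF init, of k]
    by (simp add: nn_integral_bind[where B="PiM {0..<Suc k} (\<lambda>_. obs_space n)"] history_space_def
        measurable_cong_sets[OF sets_C[OF init, of k] refl])
  also have "\<dots> = (\<integral>\<^sup>+h. \<integral>\<^sup>+z. f (h(k := z)) \<partial>obs_kernel n x K k h \<partial>C 0 k (\<lambda>_. undefined))"
    using f space_C[OF init, of k]
    by (intro nn_integral_cong nn_integral_eP) (simp_all add: history_space_def)
  finally show ?thesis .
qed

section \<open>Change of measure and divergence on finite histories\<close>

text \<open>The strategy does not know the signal: both kernels draw the action from the same
  \<open>K k h\<close>, so that the change takes place in the inner integral over the noise.\<close>

lemma nn_integral_obs_kernel_change:
  assumes K: "sensing_strategy n K" and h: "h \<in> space (history_space n k)"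
    and g: "g \<in> borel_measurable (obs_space n)"
  shows "(\<integral>\<^sup>+z. g z \<partial>obs_kernel n x K k h) =
    (\<integral>\<^sup>+z. ennreal (obs_ratio x z) * g z \<partial>obs_kernel n (\<lambda>_. 0) K k h)"
proof -
  have g': "(\<lambda>z. ennreal (obs_ratio x z) * g z) \<in> borel_measurable (obs_space n)"
    using g by measurable
  show ?thesis
    unfolding nn_integral_obs_kernel[OF K h g] nn_integral_obs_kernel[OF K h g']
    by (intro nn_integral_cong nn_integral_measure_entry[OF g])
       (auto simp: space_strategy[OF K h] action_space_def space_pair_measure)
qed

lemma measurable_nn_integral_obs_kernel:
  assumes K: "sensing_strategy n K" and f: "f \<in> borel_measurable (history_space n (Suc k))"
  shows "(\<lambda>h. \<integral>\<^sup>+z. f (h(k := z)) \<partial>obs_kernel n x K k h) \<in> borel_measurable (history_space n k)"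
proof -
  interpret Ionescu_Tulcea "obs_kernel n x K" "\<lambda>_. obs_space n"
    using K by (rule Ionescu_Tulcea_obs_kernel)
  have "(\<lambda>h. \<integral>\<^sup>+h'. f h' \<partial>eP k h) \<in> borel_measurable (history_space n k)"
    unfolding history_space_def
    by (rule measurable_compose[OF measurable_eP nn_integral_measurable_subprob_algebra])
       (use f in \<open>simp add: history_space_def\<close>)
  also have "?this \<longleftrightarrow> ?thesis"
    using f by (intro measurable_cong nn_integral_eP) (simp_all add: history_space_def)
  finally show ?thesis .
qed

text \<open>Induction on the length with \<open>f\<close> arbitrary, since the hypothesis is applied
  to the integral of \<open>f\<close> over the last observation. The last factor of the ratio comes
  from the one-step change of measure.\<close>

lemma nn_integral_history_law_change:
  assumes K: "sensing_strategy n K"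
  shows "f \<in> borel_measurable (history_space n k) \<Longrightarrow>
    (\<integral>\<^sup>+h. f h \<partial>history_law n x K k) =
    (\<integral>\<^sup>+h. ennreal (path_ratio x k h) * f h \<partial>history_law n (\<lambda>_. 0) K k)"
proof (induction k arbitrary: f)
  case 0
  interpret X: Ionescu_Tulcea "obs_kernel n x K" "\<lambda>_. obs_space n"
    using K by (rule Ionescu_Tulcea_obs_kernel)
  interpret Z: Ionescu_Tulcea "obs_kernel n (\<lambda>_. 0) K" "\<lambda>_. obs_space n"
    using K by (rule Ionescu_Tulcea_obs_kernel)
  show ?case
    by (simp add: path_ratio_def)
next
  case (Suc k)
  let ?Z = "\<lambda>_. 0 :: real"
  have "(\<integral>\<^sup>+h. f h \<partial>history_law n x K (Suc k)) =
      (\<integral>\<^sup>+h. ennreal (path_ratio x k h) * (\<integral>\<^sup>+z. f (h(k := z)) \<partial>obs_kernel n x K k h)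
        \<partial>history_law n ?Z K k)"
    unfolding nn_integral_history_law_Suc[OF K Suc.prems]
    by (rule Suc.IH[OF measurable_nn_integral_obs_kernel[OF K Suc.prems]])
  also have "\<dots> = (\<integral>\<^sup>+h. \<integral>\<^sup>+z. ennreal (path_ratio x (Suc k) (h(k := z))) * f (h(k := z))
      \<partial>obs_kernel n ?Z K k h \<partial>history_law n ?Z K k)"
  proof (intro nn_integral_cong)
    fix h assume "h \<in> space (history_law n ?Z K k)"
    then have h: "h \<in> space (history_space n k)"
      using sets_eq_imp_space_eq[OF sets_history_law[OF K]] by blast
    have g[measurable]: "(\<lambda>z. f (h(k := z))) \<in> borel_measurable (obs_space n)"
      using measurable_compose[OF measurable_history_fun_upd[OF h] Suc.prems] .
    have "ennreal (path_ratio x k h) * (\<integral>\<^sup>+z. f (h(k := z)) \<partial>obs_kernel n x K k h) =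
        (\<integral>\<^sup>+z. ennreal (path_ratio x k h) * (ennreal (obs_ratio x z) * f (h(k := z)))
          \<partial>obs_kernel n ?Z K k h)"
      unfolding nn_integral_obs_kernel_change[OF K h g]
      by (subst nn_integral_cmult)
         (simp_all add: measurable_cong_sets[OF sets_obs_kernel[OF K h] refl])
    then show "ennreal (path_ratio x k h) * (\<integral>\<^sup>+z. f (h(k := z)) \<partial>obs_kernel n x K k h) =
        (\<integral>\<^sup>+z. ennreal (path_ratio x (Suc k) (h(k := z))) * f (h(k := z)) \<partial>obs_kernel n ?Z K k h)"
      by (simp add: path_ratio_fun_upd ennreal_mult path_ratio_pos obs_ratio_pos less_imp_le mult.assoc)
  qed
  also have "\<dots> = (\<integral>\<^sup>+h. ennreal (path_ratio x (Suc k) h) * f h \<partial>history_law n ?Z K (Suc k))"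
    using Suc.prems by (intro nn_integral_history_law_Suc[OF K, symmetric]) measurable
  finally show ?case .
qed

text \<open>Given \<open>h\<close>, the past ratio is a constant \<open>c\<close>; the Gaussian
  chain rule holds for each action and is averaged over the actions.\<close>

lemma nn_integral_log_gap_obs_kernel:
  assumes K: "sensing_strategy n K" and h: "h \<in> space (history_space n k)" and c: "c > 0"
  shows "(\<integral>\<^sup>+z. ennreal (log_gap (c * obs_ratio x z)) \<partial>obs_kernel n (\<lambda>_. 0) K k h) =
    ennreal (log_gap c) + (\<integral>\<^sup>+z. obs_info x z \<partial>obs_kernel n (\<lambda>_. 0) K k h)"
proof -
  interpret N: prob_space std_normal_distribution
    by (rule prob_space_normal_density) simp
  interpret Kh: prob_space "K k h"
    using K h by (rule prob_space_strategy)
  have "Pair 0 \<in> action_space n \<rightarrow>\<^sub>M obs_space n"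
    unfolding obs_space_def by simp
  from measurable_compose[OF this measurable_obs_info, of x]
  have "(\<lambda>a. obs_info x (0, a)) \<in> borel_measurable (K k h)"
    by (simp add: measurable_cong_sets[OF sets_strategy[OF K h] refl])
  then show ?thesis
    using N.emeasure_space_1 Kh.emeasure_space_1
    by (simp add: nn_integral_obs_kernel[OF K h] nn_integral_log_gap_measure_entry[OF c]
        obs_info_measure_entry nn_integral_add)
qed

text \<open>Chain rule for the divergence: each step adds the conditional expectation of its
  information, whatever rule selected the action. Adaptivity thus matters only through where the
  null law spends its precision.\<close>

lemma nn_integral_log_gap_path_ratio:
  assumes K: "sensing_strategy n K"
  shows "(\<integral>\<^sup>+h. ennreal (log_gap (path_ratio x k h)) \<partial>history_law n (\<lambda>_. 0) K k) =
    (\<integral>\<^sup>+h. (\<Sum>i<k. obs_info x (h i)) \<partial>history_law n (\<lambda>_. 0) K k)"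
proof (induction k)
  case 0
  show ?case by (simp add: path_ratio_def log_gap_def)
next
  case (Suc k)
  let ?P = "history_law n (\<lambda>_. 0) K" and ?k = "obs_kernel n (\<lambda>_. 0) K k"
  have space: "h \<in> space (history_space n k)" if "h \<in> space (?P k)" for h
    using that sets_eq_imp_space_eq[OF sets_history_law[OF K]] by blast
  have comp[measurable]: "(\<lambda>h. h i) \<in> history_space n k' \<rightarrow>\<^sub>M obs_space n" if "i < k'" for i k'
    using that unfolding history_space_def by (intro measurable_component_singleton) auto
  note cong = measurable_cong_sets[OF sets_history_law[OF K] refl]
  have I: "(\<lambda>h. \<integral>\<^sup>+z. obs_info x z \<partial>?k h) \<in> borel_measurable (history_space n k)"
  proof -
    have "(\<lambda>h. obs_info x (h k)) \<in> borel_measurable (history_space n (Suc k))"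
      by measurable
    from measurable_nn_integral_obs_kernel[OF K this, where x="\<lambda>_. 0"] show ?thesis
      by (simp only: fun_upd_same)
  qed
  have "(\<integral>\<^sup>+h. ennreal (log_gap (path_ratio x (Suc k) h)) \<partial>?P (Suc k)) =
      (\<integral>\<^sup>+h. \<integral>\<^sup>+z. ennreal (log_gap (path_ratio x k h * obs_ratio x z)) \<partial>?k h \<partial>?P k)"
    by (subst nn_integral_history_law_Suc[OF K]) (measurable, simp add: path_ratio_fun_upd)
  also have "\<dots> = (\<integral>\<^sup>+h. ennreal (log_gap (path_ratio x k h)) + (\<integral>\<^sup>+z. obs_info x z \<partial>?k h) \<partial>?P k)"
    by (intro nn_integral_cong nn_integral_log_gap_obs_kernel[OF K space] path_ratio_pos)
  also have "\<dots> = (\<integral>\<^sup>+h. (\<Sum>i<k. obs_info x (h i)) \<partial>?P k) + (\<integral>\<^sup>+h. (\<integral>\<^sup>+z. obs_info x z \<partial>?k h) \<partial>?P k)"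
    by (subst nn_integral_add) (simp_all add: I Suc.IH cong)
  also have "\<dots> = (\<integral>\<^sup>+h. (\<Sum>i<k. obs_info x (h i)) + (\<integral>\<^sup>+z. obs_info x z \<partial>?k h) \<partial>?P k)"
    by (subst nn_integral_add) (simp_all add: I cong)
  also have "\<dots> = (\<integral>\<^sup>+h. \<integral>\<^sup>+z. (\<Sum>i<Suc k. obs_info x ((h(k := z)) i)) \<partial>?k h \<partial>?P k)"
  proof (intro nn_integral_cong)
    fix h assume "h \<in> space (?P k)"
    note h = space[OF this]
    interpret prob_space "?k h"
      using K h by (rule prob_space_obs_kernel)
    show "(\<Sum>i<k. obs_info x (h i)) + (\<integral>\<^sup>+z. obs_info x z \<partial>?k h) =
        (\<integral>\<^sup>+z. (\<Sum>i<Suc k. obs_info x ((h(k := z)) i)) \<partial>?k h)"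
      using emeasure_space_1
      by (simp add: nn_integral_add measurable_cong_sets[OF sets_obs_kernel[OF K h] refl])
  qed
  also have "\<dots> = (\<integral>\<^sup>+h. (\<Sum>i<Suc k. obs_info x (h i)) \<partial>?P (Suc k))"
    by (rule nn_integral_history_law_Suc[OF K, symmetric]) measurable
  finally show ?case .
qed

section \<open>Error bound for tests on a finite history\<close>

text \<open>\<open>A\<close> is the rejection event. Where the likelihood ratio is bounded below,
  acceptance under the null forces acceptance under the alternative.\<close>

lemma history_test_bound:
  assumes K: "sensing_strategy n K" and \<kappa>: "\<kappa> > 0"
    and info: "(\<integral>\<^sup>+h. (\<Sum>i<k. obs_info x (h i)) \<partial>history_law n (\<lambda>_. 0) K k) \<le> ennreal \<kappa>"
    and A: "A \<in> sets (history_space n k)"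
  shows "exp (- 2 * \<kappa> - 1) / 2 \<le> measure (history_law n (\<lambda>_. 0) K k) A +
    measure (history_law n x K k) (space (history_space n k) - A)"
proof -
  let ?P = "history_law n (\<lambda>_. 0) K k" and ?Q = "history_law n x K k" and ?e = "exp (- 2 * \<kappa> - 1)"
  let ?B = "space (history_space n k) - A"
  have prob: "prob_space (history_law n y K k)" for y
    using prob_space_history_law[OF K] .
  interpret P: prob_space ?P by (rule prob)
  interpret Q: prob_space ?Q by (rule prob)
  note s = sets_history_law[OF K] note sp = sets_eq_imp_space_eq[OF s]
  note cong = measurable_cong_sets[OF s refl]
  \<comment> \<open>The threshold is twice the bound on the mean, so Markov's inequality gives this
    bad event probability at most 1/2.\<close>
  define G where "G = {h \<in> space ?P. 2 * \<kappa> \<le> log_gap (path_ratio x k h)}"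
  have [measurable]: "path_ratio x k \<in> borel_measurable ?P" by (simp add: cong)
  have G: "G \<in> sets ?P" unfolding G_def by measurable
  have A': "A \<in> sets ?P" "?B \<in> sets ?P" "?B \<in> sets ?Q" using A by (auto simp: s)
  have "emeasure ?P G \<le> emeasure ?P {h \<in> space ?P. 1 \<le> ennreal (1 / (2 * \<kappa>)) * ennreal (log_gap (path_ratio x k h))}"
    using \<kappa> by (intro emeasure_mono)
      (auto simp: G_def ennreal_mult'[symmetric] field_simps simp del: ennreal_1 simp flip: ennreal_1)
  also have "\<dots> \<le> ennreal (1 / (2 * \<kappa>)) * (\<integral>\<^sup>+h. ennreal (log_gap (path_ratio x k h)) * indicator (space ?P) h \<partial>?P)"
    by (rule nn_integral_Markov_inequality) auto
  also have "\<dots> = ennreal (1 / (2 * \<kappa>)) * (\<integral>\<^sup>+h. ennreal (log_gap (path_ratio x k h)) \<partial>?P)"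
    by (intro arg_cong2[where f="(*)"] refl nn_integral_cong) simp
  also have "\<dots> \<le> ennreal (1 / (2 * \<kappa>)) * ennreal \<kappa>"
    using info unfolding nn_integral_log_gap_path_ratio[OF K] by (intro mult_left_mono) auto
  also have "\<dots> = ennreal (1 / 2)"
    using \<kappa> by (simp add: ennreal_mult'[symmetric])
  finally have PG: "P.prob G \<le> 1 / 2"
    unfolding P.emeasure_eq_measure by (subst (asm) ennreal_le_iff) auto
  have "ennreal ?e * emeasure ?P (?B - G) = (\<integral>\<^sup>+h. ennreal ?e * indicator (?B - G) h \<partial>?P)"
    using A' G by (simp add: nn_integral_cmult_indicator)
  also have "\<dots> \<le> (\<integral>\<^sup>+h. ennreal (path_ratio x k h) * indicator ?B h \<partial>?P)"
  proof (intro nn_integral_mono)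
    fix h assume h: "h \<in> space ?P"
    \<comment> \<open>Outside \<open>G\<close> the ratio \<open>L\<close> satisfies
      \<open>ln L > L - 1 - 2 * \<kappa>\<close>, and \<open>L > 0\<close>.\<close>
    have "?e \<le> path_ratio x k h" if "h \<notin> G"
    proof -
      have "- 2 * \<kappa> - 1 \<le> ln (path_ratio x k h)"
        using that h path_ratio_pos[of x k h] by (simp add: G_def log_gap_def)
      then show ?thesis
        using path_ratio_pos[of x k h] by (simp add: ln_ge_iff)
    qed
    then show "ennreal ?e * indicator (?B - G) h \<le> ennreal (path_ratio x k h) * indicator ?B h"
      by (auto split: split_indicator simp: ennreal_leI)
  qed
  also have "\<dots> = emeasure ?Q ?B"
    using nn_integral_history_law_change[OF K, of "indicator ?B" k x] A A' by simp
  finally have "?e * P.prob (?B - G) \<le> Q.prob ?B"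
    by (simp add: P.emeasure_eq_measure Q.emeasure_eq_measure ennreal_mult'[symmetric])
  moreover have "1 - P.prob A = P.prob ?B"
    using P.prob_compl[OF A'(1)] by (simp add: sp)
  moreover have "P.prob ?B \<le> P.prob (?B - G) + P.prob G"
    using measure_Un_le[of "?B - G" ?P G] A' G
      P.finite_measure_mono[of ?B "(?B - G) \<union> G"] by auto
  \<comment> \<open>As \<open>G\<close> has mass at most 1/2, the part of acceptance outside
    \<open>G\<close> has null probability at least \<open>1 / 2 - P.prob A\<close>. The term with
    \<open>?e\<close> times \<open>P.prob A\<close> is then absorbed into \<open>P.prob A\<close>
    because \<open>?e \<le> 1\<close>.\<close>
  ultimately have "?e * (1 / 2 - P.prob A) \<le> Q.prob ?B"
    using PG by (intro order_trans[OF mult_left_mono[of "1 / 2 - P.prob A" "P.prob (?B - G)" ?e]]) auto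
  moreover have "?e * P.prob A \<le> P.prob A"
    using \<kappa> by (intro mult_left_le_one_le) auto
  ultimately show ?thesis
    by (simp add: algebra_simps)
qed

section \<open>From finite histories to the whole data sequence\<close>

text \<open>Finitely many \<open>B i\<close> exhaust the union up to \<open>e / 2\<close>, and the
  \<open>N\<close> replacement errors add up to at most \<open>e / 2\<close>. Quantifying over all
  large \<open>N\<close> first and over \<open>A\<close> afterwards lets two measures share one
  \<open>N\<close> and lets the tolerance depend on it; \<open>Suc N\<close> keeps that tolerance
  positive at \<open>N = 0\<close>.\<close>

lemma finite_measure_approx_UN:
  assumes P: "finite_measure P" and B: "\<And>i::nat. B i \<in> sets P" and e: "e > 0"
  shows "\<forall>\<^sub>F N in sequentially. \<forall>A. (\<forall>i. A i \<in> sets P \<and>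
      measure P ((B i - A i) \<union> (A i - B i)) < e / (2 * real (Suc N))) \<longrightarrow>
    measure P (((\<Union>i. B i) - (\<Union>i<N. A i)) \<union> ((\<Union>i<N. A i) - (\<Union>i. B i))) < e"
proof -
  interpret finite_measure P by fact
  note B[measurable]
  define U where "U = (\<Union>i. B i)"
  have U[measurable]: "U \<in> sets P" unfolding U_def by measurable
  have "(\<lambda>N. measure P (\<Union>i<N. B i)) \<longlonglongrightarrow> measure P (\<Union>N. \<Union>i<N. B i)"
    by (rule finite_Lim_measure_incseq) (auto simp: incseq_def intro: less_le_trans)
  also have "(\<Union>N. \<Union>i<N. B i) = U" by (auto simp: U_def)
  finally have "\<forall>\<^sub>F N in sequentially. measure P U - e / 2 < measure P (\<Union>i<N. B i)"
    using e by (auto elim: order_tendstoD)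
  then show ?thesis
    unfolding U_def[symmetric]
  proof (eventually_elim, safe)
    fix N A
    assume N: "measure P U - e / 2 < measure P (\<Union>i<N. B i)"
      and "\<forall>i. A i \<in> sets P \<and> measure P ((B i - A i) \<union> (A i - B i)) < e / (2 * real (Suc N))"
    then have A[measurable]: "\<And>i. A i \<in> sets P"
      and d: "\<And>i. measure P ((B i - A i) \<union> (A i - B i)) < e / (2 * real (Suc N))" by auto
    let ?D = "\<Union>i<N. (B i - A i) \<union> (A i - B i)" and ?V = "\<Union>i<N. B i"
    have "measure P ((U - (\<Union>i<N. A i)) \<union> ((\<Union>i<N. A i) - U)) \<le> measure P ((U - ?V) \<union> ?D)"
      by (intro finite_measure_mono) (auto simp: U_def)
    also have "\<dots> \<le> measure P (U - ?V) + measure P ?D"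
      by (intro measure_Un_le) auto
    also have "measure P (U - ?V) = measure P U - measure P ?V"
      by (intro finite_measure_Diff) (auto simp: U_def)
    also have "measure P ?D \<le> (\<Sum>i<N. measure P ((B i - A i) \<union> (A i - B i)))"
      by (intro finite_measure_subadditive_finite) auto
    also have "\<dots> \<le> real (card {..<N}) * (e / (2 * real (Suc N)))"
      by (intro sum_bounded_above less_imp_le d)
    also have "\<dots> \<le> e / 2" using e by (simp add: field_simps)
    finally show "measure P ((U - (\<Union>i<N. A i)) \<union> ((\<Union>i<N. A i) - U)) < e"
      using N by simp
  qed
qed

text \<open>The approximable sets contain \<open>G\<close> and are closed under complements and
  countable unions. One \<open>A\<close> has to serve both measures, because the two errors of a
  test are evaluated under different laws.\<close>

lemma sigma_sets_approx_algebra: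
  assumes G: "algebra \<Omega> G" and P: "finite_measure P" and Q: "finite_measure Q"
    and sP: "sets P = sigma_sets \<Omega> G" and sQ: "sets Q = sigma_sets \<Omega> G"
    and B: "B \<in> sigma_sets \<Omega> G" and e: "e > 0"
  obtains A where "A \<in> G" "measure P ((B - A) \<union> (A - B)) < e" "measure Q ((B - A) \<union> (A - B)) < e"
proof -
  interpret algebra \<Omega> G by fact
  have "\<exists>A\<in>G. measure P ((B - A) \<union> (A - B)) < e \<and> measure Q ((B - A) \<union> (A - B)) < e"
    using B e
  proof (induction arbitrary: e)
    case (Basic a)
    then show ?case by (intro bexI[of _ a]) auto
  next
    case Empty
    then show ?case by (intro bexI[of _ "{}"]) auto
  next
    case (Compl a)
    then obtain A where A: "A \<in> G" "measure P ((a - A) \<union> (A - a)) < e" "measure Q ((a - A) \<union> (A - a)) < e"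
      by blast
    have "a \<subseteq> \<Omega>"
      using sigma_sets_into_sp[OF space_closed Compl.hyps] .
    then have "((\<Omega> - a) - (\<Omega> - A)) \<union> ((\<Omega> - A) - (\<Omega> - a)) = (a - A) \<union> (A - a)"
      using sets_into_space[OF A(1)] by auto
    then show ?case using A by (intro bexI[of _ "\<Omega> - A"]) auto
  next
    case (Union B)
    have B: "B i \<in> sets P" "B i \<in> sets Q" for i
      using Union.hyps by (auto simp: sP sQ)
    have GP: "A \<in> sets P" "A \<in> sets Q" if "A \<in> G" for A
      using that by (auto simp: sP sQ intro: sigma_sets.Basic)
    \<comment> \<open>One \<open>N\<close> good for both measures is fixed first; only then are the
      sets \<open>B i\<close> approximated, with a tolerance depending on \<open>N\<close>.\<close>
    from eventually_happens[OF eventually_conj[OF finite_measure_approx_UN[OF P, of B, OF B(1) Union.prems]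
        finite_measure_approx_UN[OF Q, of B, OF B(2) Union.prems]]]
    obtain N where N:
      "\<And>A. (\<And>i. A i \<in> sets P \<and> measure P ((B i - A i) \<union> (A i - B i)) < e / (2 * real (Suc N))) \<Longrightarrow>
        measure P (((\<Union>i. B i) - (\<Union>i<N. A i)) \<union> ((\<Union>i<N. A i) - (\<Union>i. B i))) < e"
      "\<And>A. (\<And>i. A i \<in> sets Q \<and> measure Q ((B i - A i) \<union> (A i - B i)) < e / (2 * real (Suc N))) \<Longrightarrow>
        measure Q (((\<Union>i. B i) - (\<Union>i<N. A i)) \<union> ((\<Union>i<N. A i) - (\<Union>i. B i))) < e"
      by auto
    have "e / (2 * real (Suc N)) > 0" using Union.prems by simp
    from Union.IH[OF this] obtain A where A: "\<And>i. A i \<in> G"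
      "\<And>i. measure P ((B i - A i) \<union> (A i - B i)) < e / (2 * real (Suc N))"
      "\<And>i. measure Q ((B i - A i) \<union> (A i - B i)) < e / (2 * real (Suc N))"
      by metis
    show ?case
      using A(1) by (intro bexI[of _ "\<Union>i<N. A i"] conjI N) (auto simp: A(2,3) GP simp del: of_nat_Suc)
  qed
  then show ?thesis using that by blast
qed

lemma measurable_restrict_data_law:
  assumes "sensing_strategy n K"
  shows "(\<lambda>D. restrict D {0..<k}) \<in> data_law n x K \<rightarrow>\<^sub>M history_space n k"
  unfolding history_space_def measurable_cong_sets[OF sets_data_law[OF assms] refl] data_space_def
  by (rule measurable_restrict_subset) simp

lemma space_data_law:
  "sensing_strategy n K \<Longrightarrow> space (data_law n x K) = space (data_space n)"
  by (rule sets_eq_imp_space_eq[OF sets_data_law])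

text \<open>The bound for finite histories is uniform in their length, so it survives the
  approximation of the rejection event by cylinders up to an arbitrary \<open>e\<close>.\<close>

lemma data_test_bound:
  assumes K: "sensing_strategy n K" and \<kappa>: "\<kappa> > 0"
    and info: "(\<integral>\<^sup>+D. (\<Sum>i. obs_info x (D i)) \<partial>data_law n (\<lambda>_. 0) K) \<le> ennreal \<kappa>"
    and B: "B \<in> sets (data_space n)"
  shows "exp (- 2 * \<kappa> - 1) / 2 \<le> measure (data_law n (\<lambda>_. 0) K) B +
    measure (data_law n x K) (space (data_space n) - B)"
proof (rule field_le_epsilon)
  fix e :: real assume e: "e > 0"
  let ?P = "data_law n (\<lambda>_. 0) K" and ?Q = "data_law n x K" and ?\<Omega> = "space (data_space n)"
  interpret P: prob_space ?P using K by (rule prob_space_data_law)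
  interpret Q: prob_space ?Q using K by (rule prob_space_data_law)
  interpret IT: Ionescu_Tulcea "obs_kernel n x K" "\<lambda>_. obs_space n"
    using K by (rule Ionescu_Tulcea_obs_kernel)
  have gen: "sets (data_space n) = sigma_sets ?\<Omega> IT.PF.generator"
    unfolding data_space_def by (rule IT.PF.sets_PiM_generator)
  have alg: "algebra ?\<Omega> IT.PF.generator"
    unfolding data_space_def by (rule IT.PF.algebra_generator)
  \<comment> \<open>Replacing \<open>B\<close> by \<open>A\<close> changes each of the two error
    probabilities by less than \<open>e / 2\<close>.\<close>
  obtain A where A: "A \<in> IT.PF.generator"
    "P.prob ((B - A) \<union> (A - B)) < e / 2" "Q.prob ((B - A) \<union> (A - B)) < e / 2"
    by (rule sigma_sets_approx_algebra[OF alg P.finite_measure_axioms Q.finite_measure_axioms, of B "e / 2"])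
       (use e B K in \<open>auto simp: sets_data_law gen\<close>)
  from A(1) obtain J X where J: "finite J" and X: "X \<in> sets (PiM J (\<lambda>_. obs_space n))"
    and AX: "A = prod_emb UNIV (\<lambda>_. obs_space n) J X"
    by (auto elim: IT.PF.generator.cases)
  \<comment> \<open>A cylinder over a finite index set is an event of an initial segment, to which
    the finite bound applies.\<close>
  obtain k where k: "J \<subseteq> {0..<k}"
    using finite_nat_bounded[OF J] by (auto simp: lessThan_atLeast0)
  let ?r = "\<lambda>D. restrict D {0..<k}"
  define Y where "Y = prod_emb {0..<k} (\<lambda>_. obs_space n) J X"
  have Y: "Y \<in> sets (history_space n k)"
    unfolding Y_def history_space_def using k X by (intro measurable_prod_emb)
  have AY: "A = ?r -` Y \<inter> ?\<Omega>"
    unfolding AX Y_def using prod_emb_trans[OF k subset_UNIV, of "\<lambda>_. obs_space n" X]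
    by (simp add: prod_emb_def data_space_def space_PiM)
  have A_sets: "A \<in> sets (data_space n)"
    using A(1) gen by auto
  have cyl: "measure (data_law n y K) (?r -` Z \<inter> ?\<Omega>) = measure (history_law n y K k) Z"
    if "Z \<in> sets (history_space n k)" for y Z
    using that by (simp add: distr_data_law[OF K, symmetric] space_data_law[OF K]
        measure_distr[OF measurable_restrict_data_law[OF K]])
  have "(\<integral>\<^sup>+h. (\<Sum>i<k. obs_info x (h i)) \<partial>history_law n (\<lambda>_. 0) K k) =
      (\<integral>\<^sup>+D. (\<Sum>i<k. obs_info x (D i)) \<partial>?P)"
  proof -
    have [measurable]: "(\<lambda>h. h i) \<in> history_space n k \<rightarrow>\<^sub>M obs_space n" if "i < k" for i
      using that unfolding history_space_def by (intro measurable_component_singleton) auto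
    show ?thesis
      unfolding distr_data_law[OF K, symmetric]
      by (subst nn_integral_distr[OF measurable_restrict_data_law[OF K]]) simp_all
  qed
  \<comment> \<open>Truncation can only lower the information, so \<open>\<kappa>\<close> serves for
    every \<open>k\<close>.\<close>
  also have "\<dots> \<le> (\<integral>\<^sup>+D. (\<Sum>i. obs_info x (D i)) \<partial>?P)"
    by (intro nn_integral_mono sum_le_suminf) auto
  finally have "(\<integral>\<^sup>+h. (\<Sum>i<k. obs_info x (h i)) \<partial>history_law n (\<lambda>_. 0) K k) \<le> ennreal \<kappa>"
    using info by simp
  from history_test_bound[OF K \<kappa> this Y]
  have "exp (- 2 * \<kappa> - 1) / 2 \<le> P.prob A + Q.prob (?r -` (space (history_space n k) - Y) \<inter> ?\<Omega>)"
    using Y by (simp add: cyl AY sets.compl_sets)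
  also have "?r -` (space (history_space n k) - Y) \<inter> ?\<Omega> = ?\<Omega> - A"
    unfolding AY using measurable_space[OF measurable_restrict_data_law[OF K, of k x]]
    by (auto simp: space_data_law[OF K])
  also have "P.prob A \<le> P.prob B + P.prob ((B - A) \<union> (A - B))"
    using A_sets B by (intro order_trans[OF P.finite_measure_mono measure_Un_le])
      (auto simp: sets_data_law[OF K])
  also have "Q.prob (?\<Omega> - A) \<le> Q.prob (?\<Omega> - B) + Q.prob ((B - A) \<union> (A - B))"
    using A_sets B by (intro order_trans[OF Q.finite_measure_mono measure_Un_le])
      (auto simp: sets_data_law[OF K])
  finally show "exp (- 2 * \<kappa> - 1) / 2 \<le> P.prob B + Q.prob (?\<Omega> - B) + e"
    using A(2,3) by simp
qed

section \<open>Averaging over the class\<close>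

text \<open>Probability under the uniform law is a fraction of the members, so the symmetry
  assumption is a count. Full range makes the union of the class a subset of \<open>{1..n}\<close>
  of the same cardinality, hence all of it.\<close>

lemma card_symmetric_class:
  assumes sym: "symmetric_class n s \<C>" and full: "full_range n \<C>" and i: "i \<in> {1..n}"
  shows "real (card {S \<in> \<C>. i \<in> S}) = real (card \<C>) * real s / real n"
proof -
  have sub: "\<C> \<subseteq> Pow {1..n}" and ne: "\<C> \<noteq> {}"
    using sym by (auto simp: symmetric_class_def)
  then have fin: "finite \<C>"
    by (meson finite_Pow_iff finite_atLeastAtMost finite_subset)
  have "\<Union>\<C> = {1..n}"
    using sub full by (intro card_subset_eq) (auto simp: full_range_def)
  then have "measure_pmf.prob (pmf_of_set \<C>) {S. i \<in> S} = real s / real n"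
    using sym i unfolding symmetric_class_def by simp
  moreover have "measure_pmf.prob (pmf_of_set \<C>) {S. i \<in> S} = real (card {S \<in> \<C>. i \<in> S}) / real (card \<C>)"
    using measure_pmf_of_set[OF ne fin, of "{S. i \<in> S}"] by (simp add: Collect_conj_eq)
  moreover have "card \<C> > 0" using ne fin by (simp add: card_gt_0_iff)
  ultimately show ?thesis by (simp add: field_simps)
qed

lemma signal_empty: "signal \<mu> {} = (\<lambda>_. 0)"
  by (simp add: signal_def fun_eq_iff)

text \<open>Summed over the class, the information of any observation is a constant times its
  precision, because every entry lies in equally many members. The budget bounds the total
  precision, and the least informative member is at most the average.\<close>

lemma least_informative_support:
  assumes sym: "symmetric_class n s \<C>" and full: "full_range n \<C>" and n: "n \<ge> 1" and m: "m > 0"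
    and K: "sensing_strategy n K" and budget: "within_budget n m \<mu> \<C> K"
  obtains S where "S \<in> \<C>"
    "(\<integral>\<^sup>+D. (\<Sum>i. obs_info (signal \<mu> S) (D i)) \<partial>data_law n (\<lambda>_. 0) K)
      \<le> ennreal (\<mu>\<^sup>2 * real s * m / (2 * real n))"
proof -
  let ?P = "data_law n (\<lambda>_. 0) K" and ?\<kappa> = "\<mu>\<^sup>2 * real s * m / (2 * real n)"
  define I where "I S = (\<integral>\<^sup>+D. (\<Sum>i. obs_info (signal \<mu> S) (D i)) \<partial>?P)" for S
  interpret P: prob_space ?P using K by (rule prob_space_data_law)
  have sub: "\<C> \<subseteq> Pow {1..n}" and ne: "\<C> \<noteq> {}"
    using sym by (auto simp: symmetric_class_def)
  then have fin: "finite \<C>"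
    by (meson finite_Pow_iff finite_atLeastAtMost finite_subset)
  have card: "card \<C> > 0" using ne fin by (simp add: card_gt_0_iff)
  have comp[measurable]: "(\<lambda>D. D i) \<in> ?P \<rightarrow>\<^sub>M obs_space n" for i
    unfolding measurable_cong_sets[OF sets_data_law[OF K] refl] data_space_def by simp
  \<comment> \<open>The number of members containing a given entry, times the information
    \<open>\<mu>\<^sup>2 / 2\<close> per unit of precision.\<close>
  define c where "c = real (card \<C>) * real s / real n * \<mu>\<^sup>2 / 2"
  have c: "c \<ge> 0" by (simp add: c_def)
  have sum_info: "(\<Sum>S\<in>\<C>. obs_info (signal \<mu> S) z) = ennreal c * ennreal ((snd (snd z))\<^sup>2)"
    if "z \<in> space (obs_space n)" for z
  proof -
    obtain y a \<gamma> where z: "z = (y, a, \<gamma>)" by (cases z)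
    have a: "a \<in> {1..n}"
      using that by (auto simp: z obs_space_def action_space_def space_pair_measure)
    have "(\<Sum>S\<in>\<C>. obs_info (signal \<mu> S) z) = ennreal (\<Sum>S\<in>\<C>. (\<gamma> * signal \<mu> S a)\<^sup>2 / 2)"
      by (simp add: z obs_info_def sum_ennreal)
    also have "(\<Sum>S\<in>\<C>. (\<gamma> * signal \<mu> S a)\<^sup>2 / 2) = (\<Sum>S\<in>\<C>. if a \<in> S then (\<gamma> * \<mu>)\<^sup>2 / 2 else 0)"
      by (intro sum.cong) (auto simp: signal_def)
    also have "\<dots> = real (card {S \<in> \<C>. a \<in> S}) * ((\<gamma> * \<mu>)\<^sup>2 / 2)"
      using fin by (simp add: sum.If_cases Collect_conj_eq)
    also have "\<dots> = c * \<gamma>\<^sup>2"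
      unfolding card_symmetric_class[OF sym full a] by (simp add: c_def power_mult_distrib)
    finally show ?thesis using c by (simp add: z ennreal_mult)
  qed
  have "(\<Sum>S\<in>\<C>. I S) = (\<integral>\<^sup>+D. (\<Sum>S\<in>\<C>. \<Sum>i. obs_info (signal \<mu> S) (D i)) \<partial>?P)"
    unfolding I_def by (intro nn_integral_sum[symmetric]) measurable
  also have "\<dots> = (\<integral>\<^sup>+D. ennreal c * (\<Sum>i. ennreal ((snd (snd (D i)))\<^sup>2)) \<partial>?P)"
  proof (intro nn_integral_cong)
    fix D assume "D \<in> space ?P"
    then have "D i \<in> space (obs_space n)" for i
      by (rule measurable_space[OF comp])
    then have "(\<Sum>i. \<Sum>S\<in>\<C>. obs_info (signal \<mu> S) (D i)) = (\<Sum>i. ennreal c * ennreal ((snd (snd (D i)))\<^sup>2))"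
      by (simp add: sum_info)
    then show "(\<Sum>S\<in>\<C>. \<Sum>i. obs_info (signal \<mu> S) (D i)) = ennreal c * (\<Sum>i. ennreal ((snd (snd (D i)))\<^sup>2))"
      by (simp add: suminf_sum)
  qed
  also have "\<dots> \<le> (\<integral>\<^sup>+D. ennreal c * ennreal m \<partial>?P)"
  proof (intro nn_integral_mono_AE)
    \<comment> \<open>The information is an expectation under the null law, so the budget is taken
      at the empty support.\<close>
    have "AE D in ?P. (\<Sum>i. ennreal ((snd (snd (D i)))\<^sup>2)) \<le> ennreal m"
      using bspec[OF budget[unfolded within_budget_def] insertI1] by (simp only: signal_empty)
    then show "AE D in ?P. ennreal c * (\<Sum>i. ennreal ((snd (snd (D i)))\<^sup>2)) \<le> ennreal c * ennreal m"
      by eventually_elim (rule mult_left_mono, auto)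
  qed
  also have "\<dots> = of_nat (card \<C>) * ennreal ?\<kappa>"
    using c m P.emeasure_space_1
    by (simp add: c_def ennreal_of_nat_eq_real_of_nat ennreal_mult'[symmetric] mult_ac)
  finally have le: "(\<Sum>S\<in>\<C>. I S) \<le> of_nat (card \<C>) * ennreal ?\<kappa>" .
  have "Min (I ` \<C>) \<in> I ` \<C>"
    using fin ne by simp
  then obtain S where S: "S \<in> \<C>" "Min (I ` \<C>) = I S" by blast
  have "of_nat (card \<C>) * I S \<le> (\<Sum>S\<in>\<C>. I S)"
    using fin by (intro sum_bounded_below) (simp flip: S(2))
  with le have "of_nat (card \<C>) * I S \<le> of_nat (card \<C>) * ennreal ?\<kappa>" by simp
  then have "I S \<le> ennreal ?\<kappa>"
    using card by (subst (asm) ennreal_mult_le_mult_iff) auto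
  with S(1) show ?thesis using that by (simp add: I_def)
qed

section \<open>Risk bound and divergence of the signal scale\<close>

text \<open>The least informative support is one candidate in the maximum that defines the risk. The
  2 in the denominator of its information cancels the factor 2 in the exponent of the testing
  bound.\<close>

lemma risk_lower_bound:
  assumes sym: "symmetric_class n s \<C>" and full: "full_range n \<C>" and n: "n \<ge> 1" and s: "s \<ge> 1"
    and m: "m > 0" and \<mu>: "\<mu> > 0"
    and K: "sensing_strategy n K" and budget: "within_budget n m \<mu> \<C> K" and test: "is_test n \<Phi>"
  shows "exp (- (\<mu>\<^sup>2 * real s * m / real n) - 1) / 2 \<le> risk n \<mu> \<C> K \<Phi>"
proof -
  obtain S where S: "S \<in> \<C>" and info:
    "(\<integral>\<^sup>+D. (\<Sum>i. obs_info (signal \<mu> S) (D i)) \<partial>data_law n (\<lambda>_. 0) K)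
      \<le> ennreal (\<mu>\<^sup>2 * real s * m / (2 * real n))"
    by (rule least_informative_support[OF sym full n m K budget])
  have "\<C> \<subseteq> Pow {1..n}" using sym by (simp add: symmetric_class_def)
  then have fin: "finite \<C>"
    by (meson finite_Pow_iff finite_atLeastAtMost finite_subset)
  define B where "B = {D \<in> space (data_space n). \<Phi> D \<noteq> 0}"
  have \<Phi>: "\<Phi> \<in> data_space n \<rightarrow>\<^sub>M count_space {0, 1}"
    using test by (simp add: is_test_def)
  have binary: "\<Phi> D = 0 \<or> \<Phi> D = 1" if "D \<in> space (data_space n)" for D
    using measurable_space[OF \<Phi> that] by simp
  have "B = \<Phi> -` {1} \<inter> space (data_space n)"
    using binary by (force simp: B_def)
  then have B: "B \<in> sets (data_space n)"
    using measurable_sets[OF \<Phi>, of "{1}"] by simp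
  have compl: "space (data_space n) - B = {D \<in> space (data_space n). \<Phi> D \<noteq> 1}"
    using binary by (force simp: B_def)
  have "\<mu>\<^sup>2 * real s * m / (2 * real n) > 0"
    using \<mu> s m n by simp
  from data_test_bound[OF K this info B]
  have "exp (- (\<mu>\<^sup>2 * real s * m / real n) - 1) / 2 \<le>
      \<P>(D in law n \<mu> K {}. \<Phi> D \<noteq> 0) + \<P>(D in law n \<mu> K S. \<Phi> D \<noteq> 1)"
    unfolding compl by (simp add: B_def signal_empty space_data_law[OF K])
  also have "\<dots> \<le> risk n \<mu> \<C> K \<Phi>"
    unfolding risk_def using fin S by (intro add_left_mono Max_ge) auto
  finally show ?thesis .
qed

lemma x_min_signal:
  assumes "S \<subseteq> {1..n}" "S \<noteq> {}" "\<mu> > 0"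
  shows "x_min n (signal \<mu> S) = \<mu>"
proof -
  have "{\<bar>signal \<mu> S i\<bar> |i. i \<in> {1..n} \<and> signal \<mu> S i \<noteq> 0} = {\<mu>}"
    using assms unfolding signal_def by force
  then show ?thesis by (simp add: x_min_def)
qed

theorem corollary3p1:
  fixes s :: "nat \<Rightarrow> nat" and m \<mu> :: "nat \<Rightarrow> real" and \<C> :: "nat \<Rightarrow> nat set set"
    and K :: "nat \<Rightarrow> strategy" and \<Phi> :: "nat \<Rightarrow> (nat \<Rightarrow> real \<times> nat \<times> real) \<Rightarrow> nat"
  assumes s: "\<And>n. n \<ge> 1 \<Longrightarrow> s n \<in> {1..n}"
    and m: "\<And>n. n \<ge> 1 \<Longrightarrow> m n > 0"
    and \<mu>: "\<And>n. n \<ge> 1 \<Longrightarrow> \<mu> n > 0"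
    and symmetric: "\<And>n. n \<ge> 1 \<Longrightarrow> symmetric_class n (s n) (\<C> n)"
    and full: "\<And>n. n \<ge> 1 \<Longrightarrow> full_range n (\<C> n)"
    and strategy: "\<And>n. n \<ge> 1 \<Longrightarrow> sensing_strategy n (K n)"
    and budget: "\<And>n. n \<ge> 1 \<Longrightarrow> within_budget n (m n) (\<mu> n) (\<C> n) (K n)"
    and test: "\<And>n. n \<ge> 1 \<Longrightarrow> is_test n (\<Phi> n)"
    and risk: "(\<lambda>n. risk n (\<mu> n) (\<C> n) (K n) (\<Phi> n)) \<longlonglongrightarrow> 0"
  shows "\<exists>\<omega> :: nat \<Rightarrow> real. filterlim \<omega> at_top sequentially \<and>
    (\<forall>n\<ge>1. \<forall>S\<in>\<C> n. x_min n (signal (\<mu> n) S) \<ge> \<omega> n * sqrt (real n / (real (s n) * m n)))"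
proof (intro exI conjI allI impI ballI)
  \<comment> \<open>The quotient of \<open>\<mu> n\<close> by the critical scale makes the claimed
    inequality an equality; what remains is its divergence.\<close>
  let ?\<omega> = "\<lambda>n. \<mu> n / sqrt (real n / (real (s n) * m n))"
  show "filterlim ?\<omega> at_top sequentially"
    unfolding filterlim_at_top_gt[where c=0]
  proof (intro allI impI)
    fix Z :: real assume Z: "Z > 0"
    \<comment> \<open>By the lower bound, a risk below this level forces
      \<open>(\<mu> n)\<^sup>2 * real (s n) * m n / real n\<close>, which is the square of
      \<open>?\<omega> n\<close>, above \<open>Z\<^sup>2\<close>.\<close>
    have "\<forall>\<^sub>F n in sequentially. risk n (\<mu> n) (\<C> n) (K n) (\<Phi> n) < exp (- Z\<^sup>2 - 1) / 2"
      using risk by (rule order_tendstoD) simp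
    then show "\<forall>\<^sub>F n in sequentially. Z \<le> ?\<omega> n"
      using eventually_ge_at_top[of 1]
    proof eventually_elim
      fix n :: nat
      assume small: "risk n (\<mu> n) (\<C> n) (K n) (\<Phi> n) < exp (- Z\<^sup>2 - 1) / 2" and n: "1 \<le> n"
      have sn: "s n \<ge> 1" using s[OF n] by simp
      from risk_lower_bound[OF symmetric[OF n] full[OF n] n sn m[OF n] \<mu>[OF n] strategy[OF n]
          budget[OF n] test[OF n]] small
      have "exp (- ((\<mu> n)\<^sup>2 * real (s n) * m n / real n) - 1) < exp (- Z\<^sup>2 - 1)" by linarith
      then have "Z\<^sup>2 \<le> (\<mu> n)\<^sup>2 * real (s n) * m n / real n" by simp
      also have "\<dots> = (?\<omega> n)\<^sup>2"
        using m[OF n] sn n by (simp add: power_divide)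
      finally show "Z \<le> ?\<omega> n"
        by (rule power2_le_imp_le) (use \<mu>[OF n] m[OF n] in simp)
    qed
  qed
  fix n :: nat and S assume n: "1 \<le> n" and S: "S \<in> \<C> n"
  have "S \<subseteq> {1..n}" "card S = s n"
    using symmetric[OF n] S by (auto simp: symmetric_class_def)
  \<comment> \<open>Since \<open>s n \<ge> 1\<close>, the minimum in \<open>x_min\<close> ranges
    over a nonempty set.\<close>
  moreover from this have "S \<noteq> {}" using s[OF n] by auto
  ultimately have "x_min n (signal (\<mu> n) S) = \<mu> n"
    using \<mu>[OF n] by (intro x_min_signal)
  moreover have "sqrt (real n / (real (s n) * m n)) > 0"
    using s[OF n] m[OF n] n by simp
  ultimately show "x_min n (signal (\<mu> n) S) \<ge> ?\<omega> n * sqrt (real n / (real (s n) * m n))"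
    by (metis nonzero_eq_divide_eq order_refl less_irrefl)
qed

end
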